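(* Let $F$ be a totally preordered semifield. Then $F$ is multiplicatively Archimedean if and only if it order embeds into one of the following preordered semifields: $\mathbb{R}_+$, $\mathbb{R}_+^{\mathrm{op}}$, $\mathbb{TR}_+$, $\mathbb{TR}_+^{\mathrm{op}}$.
   Context: All structures are commutative. A semiring is a set with operations $+,\cdot$ and elements $0,1$ such that $(S,+,0)$ and $(S,\cdot,1)$ are commutative monoids, multiplication distributes over addition, and $0\cdot x=0$. A semiring homomorphism preserves $+,\cdot,0,1$. A semifield is a semiring with $1\neq 0$ in which every nonzero element is invertible; it is strict if it is not a field. A semiring preorder is a reflexive and transitive relation $\le$ such that $x\le y$ implies $a+x\le a+y$ and $ax\le ay$ for all $a,x,y$. A preordered semifield is a strict semifield $F$ with a semiring preorder such that not both $1\le 0$ and $0\le 1$. It is totally preordered if $x\le y$ or $y\le x$ for all $x,y$. $F^\times=F\setminus\{0\}$. A preordered semifield $F$ is multiplicatively Archimedean if for all $x,y\in F^\times$: if $x^k\le y$ for all $k\in\mathbb{N}$, then $x\le 1$. A preordered semifield $F$ order embeds into $K$ if there is a semiring homomorphism $f:F\to K$ with $x\le y\Leftrightarrow f(x)\le f(y)$ for all $x,y\in F$ ($f$ need not be injective). $\mathbb{R}_+$ is the semifield of nonnegative reals with the usual operations and order. $\mathbb{TR}_+$ is the set of nonnegative reals with $\max$ as addition, the usual multiplication, and the usual order. $K^{\mathrm{op}}$ denotes $K$ with the opposite preorder ($x\le y$ in $K^{\mathrm{op}}$ iff $y\le x$ in $K$). *)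

theory Defs
  imports Complex_Main "HOL-Algebra.Ring"
begin

locale semifield = semiring F + comm_monoid F for F (structure) +
  assumes one_not_zero: "\<one> \<noteq> \<zero>"
    and nonzero_invertible: "x \<in> carrier F \<Longrightarrow> x \<noteq> \<zero> \<Longrightarrow> x \<in> Units F"

locale strict_semifield = semifield +
  assumes not_field: "\<not> field F"

record 'a preordered_ring = "'a ring" +
  le :: "'a \<Rightarrow> 'a \<Rightarrow> bool" (infix \<open>\<preceq>\<index>\<close> 50)

locale preordered_semifield = strict_semifield F
  for F :: "('a, 'm) preordered_ring_scheme" (structure) +
  assumes le_refl: "x \<in> carrier F \<Longrightarrow> x \<preceq> x"
    and le_trans: "\<lbrakk>x \<in> carrier F; y \<in> carrier F; z \<in> carrier F; x \<preceq> y; y \<preceq> z\<rbrakk> \<Longrightarrow> x \<preceq> z"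
    and le_add: "\<lbrakk>a \<in> carrier F; x \<in> carrier F; y \<in> carrier F; x \<preceq> y\<rbrakk> \<Longrightarrow> a \<oplus> x \<preceq> a \<oplus> y"
    and le_mult: "\<lbrakk>a \<in> carrier F; x \<in> carrier F; y \<in> carrier F; x \<preceq> y\<rbrakk> \<Longrightarrow> a \<otimes> x \<preceq> a \<otimes> y"
    and le_nontrivial: "\<not> (\<one> \<preceq> \<zero> \<and> \<zero> \<preceq> \<one>)"

locale totally_preordered_semifield = preordered_semifield +
  assumes le_total: "x \<in> carrier F \<Longrightarrow> y \<in> carrier F \<Longrightarrow> x \<preceq> y \<or> y \<preceq> x"

(* k = 0 is included; as F is a semifield, letting k range over k > 0 only would give the
   same notion (replace y by y / x). *)
definition multiplicatively_archimedean :: "('a, 'm) preordered_ring_scheme \<Rightarrow> bool" where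
  "multiplicatively_archimedean F \<longleftrightarrow>
     (\<forall>x \<in> carrier F - {\<zero>\<^bsub>F\<^esub>}. \<forall>y \<in> carrier F - {\<zero>\<^bsub>F\<^esub>}.
        (\<forall>k::nat. x [^]\<^bsub>F\<^esub> k \<preceq>\<^bsub>F\<^esub> y) \<longrightarrow> x \<preceq>\<^bsub>F\<^esub> \<one>\<^bsub>F\<^esub>)"

(* ring_hom only demands preservation of +, * and 1; preservation of 0 is not automatic
   for semirings. *)
definition order_embeds ::
    "('a, 'm) preordered_ring_scheme \<Rightarrow> ('b, 'n) preordered_ring_scheme \<Rightarrow> bool" where
  "order_embeds F K \<longleftrightarrow>
     (\<exists>f \<in> ring_hom F K. f \<zero>\<^bsub>F\<^esub> = \<zero>\<^bsub>K\<^esub> \<and>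
        (\<forall>x \<in> carrier F. \<forall>y \<in> carrier F. x \<preceq>\<^bsub>F\<^esub> y \<longleftrightarrow> f x \<preceq>\<^bsub>K\<^esub> f y))"

definition opposite :: "('a, 'm) preordered_ring_scheme \<Rightarrow> ('a, 'm) preordered_ring_scheme" where
  "opposite K = K\<lparr>le := (\<lambda>x y. y \<preceq>\<^bsub>K\<^esub> x)\<rparr>"

definition nonneg_reals :: "real preordered_ring" where
  "nonneg_reals =
     \<lparr>carrier = {0..}, mult = (*), one = 1, zero = 0, add = (+), le = (\<le>)\<rparr>"

definition tropical_nonneg_reals :: "real preordered_ring" where
  "tropical_nonneg_reals =
     \<lparr>carrier = {0..}, mult = (*), one = 1, zero = 0, add = max, le = (\<le>)\<rparr>"

lemma not_field_no_minus_one: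
  assumes "\<And>x. x \<in> carrier F \<Longrightarrow> x \<oplus>\<^bsub>F\<^esub> \<one>\<^bsub>F\<^esub> \<noteq> \<zero>\<^bsub>F\<^esub>"
  shows "\<not> field F"
proof
  assume "field F"
  then interpret field F .
  show False
    using assms[of "\<ominus>\<^bsub>F\<^esub> \<one>\<^bsub>F\<^esub>"] by (simp add: l_neg)
qed

lemma totally_preordered_semifield_nonneg_reals:
  "totally_preordered_semifield nonneg_reals"
proof -
  have "\<not> field nonneg_reals"
    by (rule not_field_no_minus_one) (auto simp: nonneg_reals_def)
  moreover have "x \<in> Units nonneg_reals" if "x > 0" for x
    using that by (auto simp: Units_def nonneg_reals_def intro!: bexI[of _ "inverse x"])
  ultimately show ?thesis
    by unfold_locales
      (auto simp: nonneg_reals_def algebra_simps mult_left_mono intro: order_trans)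
qed

lemma totally_preordered_semifield_tropical_nonneg_reals:
  "totally_preordered_semifield tropical_nonneg_reals"
proof -
  have "\<not> field tropical_nonneg_reals"
    by (rule not_field_no_minus_one) (auto simp: tropical_nonneg_reals_def max_def)
  moreover have "x \<in> Units tropical_nonneg_reals" if "x > 0" for x
    using that by (auto simp: Units_def tropical_nonneg_reals_def intro!: bexI[of _ "inverse x"])
  ultimately show ?thesis
    by unfold_locales
      (auto simp: tropical_nonneg_reals_def algebra_simps mult_left_mono max_mult_distrib_left
        max_mult_distrib_right le_max_iff_disj intro: order_trans)
qed

lemma totally_preordered_semifield_opposite:
  assumes "totally_preordered_semifield K"
  shows "totally_preordered_semifield (opposite K)"
proof -
  interpret totally_preordered_semifield K by fact
  have sel: "carrier (opposite K) = carrier K" "mult (opposite K) = mult K"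
    "one (opposite K) = one K" "zero (opposite K) = zero K" "add (opposite K) = add K"
    "le (opposite K) = (\<lambda>x y. y \<preceq>\<^bsub>K\<^esub> x)"
    by (simp_all add: opposite_def)
  have Units: "Units (opposite K) = Units K"
    by (simp add: Units_def sel)
  have "\<not> field (opposite K)"
  proof
    assume "field (opposite K)"
    then interpret opp: field "opposite K" .
    have "cring K"
    proof (rule cringI)
      show "abelian_group K"
      proof (rule abelian_groupI)
        show "\<exists>y\<in>carrier K. y \<oplus>\<^bsub>K\<^esub> x = \<zero>\<^bsub>K\<^esub>" if "x \<in> carrier K" for x
          using opp.l_neg[of x] opp.a_inv_closed[of x] that by (auto simp: sel)
      qed (auto intro: a_assoc a_comm)
    qed (auto intro: l_distr comm_monoid_axioms)
    then have "field K"
      using opp.field_Units by (intro cring.cring_fieldI) (simp_all add: sel Units)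
    with not_field show False ..
  qed
  moreover have "semiring (opposite K)"
    by unfold_locales (auto simp: sel a_ac m_assoc l_distr r_distr)
  moreover have "comm_monoid (opposite K)"
    by unfold_locales (auto simp: sel m_ac)
  ultimately have "strict_semifield (opposite K)"
    by (intro strict_semifield.intro semifield.intro semifield_axioms.intro
          strict_semifield_axioms.intro)
      (use one_not_zero nonzero_invertible in \<open>simp_all add: sel Units\<close>)
  then have "preordered_semifield (opposite K)"
  proof (rule preordered_semifield.intro, unfold_locales, unfold sel)
    show "z \<preceq>\<^bsub>K\<^esub> x"
      if "x \<in> carrier K" "y \<in> carrier K" "z \<in> carrier K" "y \<preceq>\<^bsub>K\<^esub> x" "z \<preceq>\<^bsub>K\<^esub> y" for x y z
      using le_trans[of z y x] that by simp
  qed (use le_refl le_add le_mult le_nontrivial in auto)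
  then show ?thesis
    by (intro totally_preordered_semifield.intro totally_preordered_semifield_axioms.intro)
      (use le_total in \<open>auto simp: sel\<close>)
qed

end

theory Submission
  imports Defs
begin

text \<open>
  Being multiplicatively Archimedean is a condition on the preordered multiplicative group
  \<open>F\<^sup>\<times>\<close> alone, and it is exactly the hypothesis of Hoelder's theorem: a totally preordered abelian
  group in which only elements below \<open>1\<close> have all powers bounded above by one element maps into the ordered group of reals by a homomorphism
  \<open>\<phi>\<close> that preserves and reflects the preorder (\<open>hoelder_embedding\<close>). Passing to the opposite
  preorder if necessary, assume \<open>0 \<le> 1\<close>. Then every nonzero element lies strictly above \<open>0\<close>, so
  \<open>f x = exp (s \<cdot> \<phi> x)\<close>, \<open>f 0 = 0\<close> is, for every \<open>s > 0\<close>, a multiplicative map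
  into the nonnegative reals that preserves and reflects the preorder
  (\<open>multiplicative_representation_exists\<close>). Only addition remains, and it is governed by the
  position of \<open>1 + 1\<close> relative to \<open>1\<close>.

  If \<open>1 + 1 \<le> 1\<close>, then \<open>y \<le> x + y \<le> y + y \<le> y\<close> whenever \<open>x \<le> y\<close>, so \<open>f\<close> turns sums into maxima
  (\<open>embeds_tropical\<close>).

  Otherwise \<open>\<phi> (1 + 1) > 0\<close>, and the free parameter \<open>s\<close> can be chosen with \<open>f (1 + 1) = 2\<close>.
  On the multiples \<open>n \<cdot> 1\<close> the map \<open>f\<close> is then a monotone multiplicative function of \<open>n\<close> that
  fixes \<open>2\<close>; comparing powers of \<open>n\<close> with powers of \<open>2\<close> forces it to be the identity
  (\<open>monotone_multiplicative_nat_fixing_two\<close>). Hence the multiples of \<open>1\<close> are a ruler in \<open>F\<close>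
  that \<open>f\<close> reads correctly. Measuring \<open>n \<cdot> x\<close> and \<open>n \<cdot> y\<close> with it determines
  \<open>n \<cdot> f (x + y)\<close> up to an error of \<open>2\<close>, for every \<open>n\<close>, and additivity follows (\<open>f_add\<close>).

  Conversely, the four model semifields are Archimedean because a real number with bounded
  powers is at most \<open>1\<close>, and the property is inherited along order embeddings
  (\<open>archimedean_if_order_embeds\<close>).
\<close>

section \<open>Real numbers controlled by all their multiples or powers\<close>

lemma le_one_if_powers_bounded:
  fixes r :: real
  assumes "\<And>k::nat. r ^ k \<le> C"
  shows "r \<le> 1"
proof (rule ccontr)
  assume "\<not> r \<le> 1"
  then obtain k where "C < r ^ k" using real_arch_pow[of r C] by auto
  with assms[of k] show False by simp
qed

lemma eq_zero_if_multiples_bounded: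
  fixes a :: real
  assumes "\<And>n::nat. n > 0 \<Longrightarrow> \<bar>real n * a\<bar> \<le> C"
  shows "a = 0"
proof (rule ccontr)
  assume "a \<noteq> 0"
  then obtain n :: nat where n: "max C 0 < real n * \<bar>a\<bar>"
    using reals_Archimedean3[of "\<bar>a\<bar>"] by (meson zero_less_abs_iff)
  then have "n > 0" by (cases n) auto
  with assms[of n] n show False by (simp add: abs_mult)
qed

text \<open>
  A monotone function is pinned down up to a factor \<open>2\<close> by its values on the powers of \<open>2\<close>, and
  these are fixed here. Applied to \<open>n ^ k\<close>, this bounds both \<open>(g n / n) ^ k\<close> and
  \<open>(n / g n) ^ k\<close> by \<open>2\<close> for every \<open>k\<close>, so that neither quotient can exceed \<open>1\<close>.
\<close>

lemma monotone_multiplicative_nat_fixing_two: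
  fixes g :: "nat \<Rightarrow> real"
  assumes mono: "\<And>m n. m \<le> n \<Longrightarrow> g m \<le> g n"
    and mult: "\<And>m n. g (m * n) = g m * g n"
    and two: "g 2 = 2" and n: "n > 0"
  shows "g n = real n"
proof -
  have one: "g 1 = 1" using mult[of 1 2] two by simp
  have pow: "g (m ^ k) = g m ^ k" for m k
    by (induction k) (use one mult in simp_all)
  have pos: "g n \<ge> 1" using mono[of 1 n] one n by simp
  have between: "g n ^ k \<le> 2 * real n ^ k \<and> real n ^ k \<le> 2 * g n ^ k" for k
  proof -
    obtain m where m: "2 ^ m \<le> n ^ k" "n ^ k < 2 ^ (m + 1)"
      using ex_power_ivl1[of 2 "n ^ k"] n by auto
    have "real (2 ^ m) \<le> real (n ^ k)" "real (n ^ k) \<le> real (2 ^ (m + 1))"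
      using m by (simp_all only: of_nat_le_iff less_imp_le)
    moreover have "g (2 ^ m) \<le> g (n ^ k)" "g (n ^ k) \<le> g (2 ^ (m + 1))"
      using mono[OF m(1)] mono[of "n ^ k" "2 ^ (m + 1)"] m(2) by simp_all
    ultimately show ?thesis unfolding pow two by simp
  qed
  have "g n / n \<le> 1"
    by (rule le_one_if_powers_bounded[of _ 2])
      (use between n in \<open>simp add: power_divide divide_le_eq\<close>)
  moreover have "n / g n \<le> 1"
    by (rule le_one_if_powers_bounded[of _ 2])
      (use between pos in \<open>simp add: power_divide divide_le_eq\<close>)
  ultimately show ?thesis using n pos by (simp add: divide_le_eq)
qed

section \<open>Hoelder's theorem for totally preordered Archimedean groups\<close>

locale archimedean_group = comm_group G for G (structure) +
  fixes leq :: "'a \<Rightarrow> 'a \<Rightarrow> bool" (infix \<open>\<lesssim>\<close> 50)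
  assumes leq_trans: "\<lbrakk>x \<in> carrier G; y \<in> carrier G; z \<in> carrier G; x \<lesssim> y; y \<lesssim> z\<rbrakk> \<Longrightarrow> x \<lesssim> z"
    and leq_total: "\<lbrakk>x \<in> carrier G; y \<in> carrier G\<rbrakk> \<Longrightarrow> x \<lesssim> y \<or> y \<lesssim> x"
    and leq_mult: "\<lbrakk>a \<in> carrier G; x \<in> carrier G; y \<in> carrier G; x \<lesssim> y\<rbrakk> \<Longrightarrow> a \<otimes> x \<lesssim> a \<otimes> y"
    and archimedean: "\<lbrakk>x \<in> carrier G; y \<in> carrier G; \<And>k::nat. x [^] k \<lesssim> y\<rbrakk> \<Longrightarrow> x \<lesssim> \<one>"
begin

lemma leq_refl: "x \<in> carrier G \<Longrightarrow> x \<lesssim> x"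
  using leq_total[of x x] by simp

lemma leq_mult_both:
  assumes "a \<in> carrier G" "b \<in> carrier G" "x \<in> carrier G" "y \<in> carrier G" "a \<lesssim> b" "x \<lesssim> y"
  shows "a \<otimes> x \<lesssim> b \<otimes> y"
proof (rule leq_trans[of _ "a \<otimes> y"])
  show "a \<otimes> y \<lesssim> b \<otimes> y"
    using leq_mult[of y a b] assms by (simp add: m_comm)
  show "a \<otimes> x \<lesssim> a \<otimes> y" using assms by (intro leq_mult)
qed (use assms in simp_all)

lemma leq_mult_cancel:
  assumes "a \<in> carrier G" "x \<in> carrier G" "y \<in> carrier G" "a \<otimes> x \<lesssim> a \<otimes> y"
  shows "x \<lesssim> y"
  using leq_mult[of "inv a" "a \<otimes> x" "a \<otimes> y"] assms by (simp add: m_assoc[symmetric])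

lemma leq_nat_pow:
  assumes "x \<in> carrier G" "y \<in> carrier G" "x \<lesssim> y"
  shows "x [^] (n::nat) \<lesssim> y [^] n"
proof (induction n)
  case 0
  show ?case by (simp add: leq_refl)
next
  case (Suc n)
  then show ?case using assms leq_mult_both[of "x [^] n" "y [^] n" x y] by simp
qed

lemma leq_int_pow:
  assumes "x \<in> carrier G" "y \<in> carrier G" "x \<lesssim> y" "n \<ge> 0"
  shows "x [^] (n::int) \<lesssim> y [^] n"
  using leq_nat_pow[OF assms(1-3), of "nat n"] int_pow_int[of G _ "nat n"] assms(4) by simp

text \<open>
  The powers of a \<open>c\<close> above \<open>1\<close> form a copy of the integers inside the group. Measuring other
  elements against this scale is what produces real numbers below.
\<close>

lemma int_pow_leq_iff:
  assumes c: "c \<in> carrier G" "\<not> c \<lesssim> \<one>"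
  shows "c [^] (m::int) \<lesssim> c [^] n \<longleftrightarrow> m \<le> n"
proof -
  have le: "c [^] a \<lesssim> c [^] b" if "a \<le> b" for a b :: int
  proof -
    have "\<one> \<lesssim> c [^] (b - a)"
      using leq_int_pow[of \<one> c "b - a"] leq_total[of \<one> c] c that by simp
    then have "c [^] a \<otimes> \<one> \<lesssim> c [^] a \<otimes> c [^] (b - a)"
      using c by (intro leq_mult) simp_all
    then show ?thesis using c by (simp add: int_pow_mult[symmetric])
  qed
  have "\<not> c [^] m \<lesssim> c [^] n" if "n < m"
  proof
    assume "c [^] m \<lesssim> c [^] n"
    moreover have "c [^] (n + 1) \<lesssim> c [^] m" using le that by simp
    ultimately have "c [^] (n + 1) \<lesssim> c [^] n"
      using leq_trans[of "c [^] (n + 1)" "c [^] m" "c [^] n"] c by simp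
    then have "c [^] n \<otimes> c \<lesssim> c [^] n \<otimes> \<one>"
      using c by (simp add: int_pow_mult)
    then have "c \<lesssim> \<one>" using leq_mult_cancel[of "c [^] n" c \<one>] c by simp
    with c show False by simp
  qed
  with le show ?thesis by force
qed

text \<open>
  The scale \<open>c ^ p\<close> reaches arbitrarily far up, since its boundedness would give \<open>c \<le> 1\<close>, and
  arbitrarily far down, by the same argument for the inverse of \<open>z\<close>. So \<open>p\<close> is the integer part of the
  logarithm of \<open>z\<close> to base \<open>c\<close>.
\<close>

lemma between_int_pows:
  assumes c: "c \<in> carrier G" "\<not> c \<lesssim> \<one>" and z: "z \<in> carrier G"
  obtains p :: int where "c [^] p \<lesssim> z" "z \<lesssim> c [^] (p + 1)"
proof -
  have above: "\<exists>k::nat. \<not> c [^] (int k) \<lesssim> y" if "y \<in> carrier G" for y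
  proof (rule ccontr)
    assume "\<nexists>k::nat. \<not> c [^] (int k) \<lesssim> y"
    then have "c [^] k \<lesssim> y" for k :: nat unfolding int_pow_int by simp
    then have "c \<lesssim> \<one>" by (rule archimedean[OF c(1) that])
    with c(2) show False by simp
  qed
  obtain k :: nat where k: "\<not> c [^] (int k) \<lesssim> z" using above z by blast
  obtain j :: nat where j: "\<not> c [^] (int j) \<lesssim> inv z" using above z by blast
  have "inv z \<lesssim> c [^] (int j)" using leq_total j z c by (meson int_pow_closed inv_closed)
  then have "(z \<otimes> c [^] (- int j)) \<otimes> inv z \<lesssim> (z \<otimes> c [^] (- int j)) \<otimes> c [^] (int j)"
    using z c by (intro leq_mult) simp_all
  moreover have "(z \<otimes> c [^] (- int j)) \<otimes> inv z = c [^] (- int j)"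
    using z c by (simp only: m_comm[of z] m_assoc int_pow_closed inv_closed r_inv r_one)
  moreover have "(z \<otimes> c [^] (- int j)) \<otimes> c [^] (int j) = z"
    using z c by (simp add: m_assoc int_pow_mult[symmetric])
  ultimately have low: "c [^] (- int j) \<lesssim> z" by simp
  \<comment> \<open>Start at an exponent \<open>-j\<close> already known to be low enough, and step up to the last one that is.\<close>
  define P where "P i \<longleftrightarrow> \<not> c [^] (int i - int j) \<lesssim> z" for i
  have "P (k + j)" using k by (simp add: P_def)
  moreover have "\<not> P 0" using low by (simp add: P_def)
  ultimately obtain i where i: "\<not> P i" "P (Suc i)"
    using ex_least_nat_less[of P "k + j"] by blast
  have "\<not> c [^] (int i - int j + 1) \<lesssim> z" using i(2) by (simp add: P_def algebra_simps)
  then have "z \<lesssim> c [^] (int i - int j + 1)" using leq_total z c by auto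
  with i(1) show ?thesis by (intro that[of "int i - int j"]) (auto simp: P_def)
qed

definition lower_exponents :: "'a \<Rightarrow> 'a \<Rightarrow> real set" where
  "lower_exponents c x = {of_int p / of_int q | p q. q > 0 \<and> c [^] (p::int) \<lesssim> x [^] (q::int)}"

text \<open>
  The Dedekind-style logarithm to base \<open>c\<close>: a rational \<open>p / q\<close> is below it when
  \<open>c ^ p \<le> x ^ q\<close>, which avoids taking roots in the group.
\<close>

definition logarithm :: "'a \<Rightarrow> 'a \<Rightarrow> real" where
  "logarithm c x = Sup (lower_exponents c x)"

lemma lower_exponents_le:
  assumes c: "c \<in> carrier G" "\<not> c \<lesssim> \<one>" and x: "x \<in> carrier G"
    and "t \<in> lower_exponents c x" and q: "q > 0" "x [^] q \<lesssim> c [^] p"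
  shows "t \<le> of_int p / of_int (q::int)"
proof -
  obtain p' q' where t: "t = of_int p' / of_int q'" and q': "q' > 0" "c [^] p' \<lesssim> x [^] q'"
    using assms(4) by (auto simp: lower_exponents_def)
  have "c [^] (p' * q) \<lesssim> x [^] (q' * q)"
    using leq_int_pow[OF _ _ q'(2), of q] q c x by (simp add: int_pow_pow)
  moreover have "x [^] (q * q') \<lesssim> c [^] (p * q')"
    using leq_int_pow[OF _ _ q(2), of q'] q' c x by (simp add: int_pow_pow)
  ultimately have "c [^] (p' * q) \<lesssim> c [^] (p * q')"
    using leq_trans[of "c [^] (p' * q)" "x [^] (q' * q)" "c [^] (p * q')"] c x
    by (simp add: mult.commute)
  then have "p' * q \<le> p * q'" using c by (simp add: int_pow_leq_iff)
  then have "of_int p' * real_of_int q \<le> of_int p * of_int q'"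
    by (simp only: of_int_mult[symmetric] of_int_le_iff)
  then show ?thesis using q(1) q'(1) by (simp add: t field_simps)
qed

lemma logarithm_le:
  assumes c: "c \<in> carrier G" "\<not> c \<lesssim> \<one>" and x: "x \<in> carrier G"
    and q: "q > 0" "x [^] q \<lesssim> c [^] p"
  shows "logarithm c x \<le> of_int p / of_int (q::int)"
  unfolding logarithm_def
proof (rule cSup_least)
  obtain r :: int where "c [^] r \<lesssim> x" by (rule between_int_pows[OF c x])
  then have "of_int r / of_int 1 \<in> lower_exponents c x"
    unfolding lower_exponents_def using x by (intro CollectI exI[of _ r] exI[of _ "1::int"]) simp
  then show "lower_exponents c x \<noteq> {}" by blast
qed (use lower_exponents_le[OF c x _ q] in blast)

lemma le_logarithm:
  assumes c: "c \<in> carrier G" "\<not> c \<lesssim> \<one>" and x: "x \<in> carrier G"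
    and q: "q > 0" "c [^] p \<lesssim> x [^] q"
  shows "of_int p / of_int (q::int) \<le> logarithm c x"
  unfolding logarithm_def
proof (rule cSup_upper)
  obtain r :: int where "x \<lesssim> c [^] (r + 1)" by (rule between_int_pows[OF c x])
  then show "bdd_above (lower_exponents c x)"
    using lower_exponents_le[OF c x, of _ 1 "r + 1"] x by (intro bdd_aboveI) auto
qed (use q in \<open>auto simp: lower_exponents_def\<close>)

text \<open>
  Bracketing \<open>x ^ n\<close> and \<open>y ^ n\<close> between consecutive powers of \<open>c\<close> also brackets \<open>(x y) ^ n\<close>,
  so the defect from additivity, multiplied by \<open>n\<close>, stays within \<open>2\<close> for every \<open>n\<close>.
\<close>

lemma logarithm_mult:
  assumes c: "c \<in> carrier G" "\<not> c \<lesssim> \<one>" and x: "x \<in> carrier G" and y: "y \<in> carrier G"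
  shows "logarithm c (x \<otimes> y) = logarithm c x + logarithm c y"
proof -
  let ?d = "logarithm c (x \<otimes> y) - (logarithm c x + logarithm c y)"
  have "\<bar>real n * ?d\<bar> \<le> 2" if n: "n > 0" for n
  proof -
    have n': "int n > 0" using n by simp
    obtain p :: int where p: "c [^] p \<lesssim> x [^] (int n)" "x [^] (int n) \<lesssim> c [^] (p + 1)"
      using between_int_pows[OF c, of "x [^] (int n)"] x by auto
    obtain r :: int where r: "c [^] r \<lesssim> y [^] (int n)" "y [^] (int n) \<lesssim> c [^] (r + 1)"
      using between_int_pows[OF c, of "y [^] (int n)"] y by auto
    have "c [^] (p + r) \<lesssim> (x \<otimes> y) [^] (int n)"
      using leq_mult_both[OF _ _ _ _ p(1) r(1)] c x y
      by (simp add: int_pow_mult int_pow_distrib)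
    note lower = le_logarithm[OF c m_closed[OF x y] n' this]
    have "(x \<otimes> y) [^] (int n) \<lesssim> c [^] ((p + 1) + (r + 1))"
      using leq_mult_both[OF _ _ _ _ p(2) r(2)] c x y
      by (simp only: int_pow_mult[OF c(1), of "p + 1" "r + 1"] int_pow_distrib int_pow_closed)
    note upper = logarithm_le[OF c m_closed[OF x y] n' this]
    show ?thesis
      using lower upper le_logarithm[OF c x n' p(1)] logarithm_le[OF c x n' p(2)]
        le_logarithm[OF c y n' r(1)] logarithm_le[OF c y n' r(2)] n
      by (simp add: field_simps abs_le_iff)
  qed
  then have "?d = 0" by (rule eq_zero_if_multiples_bounded)
  then show ?thesis by simp
qed

text \<open>
  The only place where the Archimedean property is applied to an element other than the base:
  it supplies a power of \<open>z\<close> above \<open>c\<close>, so elements strictly above \<open>1\<close> are not collapsed to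
  logarithm \<open>0\<close>, and the preorder is reflected.
\<close>

lemma logarithm_pos:
  assumes c: "c \<in> carrier G" "\<not> c \<lesssim> \<one>" and z: "z \<in> carrier G" "\<not> z \<lesssim> \<one>"
  shows "logarithm c z > 0"
proof -
  obtain k :: nat where k: "\<not> z [^] k \<lesssim> c" using archimedean[of z c] z c by blast
  have "k > 0"
    using k leq_total[of \<one> c] c by (cases k) auto
  moreover have "c [^] (1::int) \<lesssim> z [^] (int k)"
    using k leq_total[of c "z [^] k"] z c by (auto simp: int_pow_int)
  ultimately have "1 / real k \<le> logarithm c z"
    using le_logarithm[OF c z(1), of "int k" 1] by simp
  moreover have "0 < 1 / real k" using \<open>k > 0\<close> by simp
  ultimately show ?thesis by linarith
qed

lemma logarithm_leq_iff:
  assumes c: "c \<in> carrier G" "\<not> c \<lesssim> \<one>" and x: "x \<in> carrier G" and y: "y \<in> carrier G"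
  shows "logarithm c x \<le> logarithm c y \<longleftrightarrow> x \<lesssim> y"
proof
  assume le: "logarithm c x \<le> logarithm c y"
  show "x \<lesssim> y"
  proof (rule ccontr)
    assume "\<not> x \<lesssim> y"
    have eq: "y \<otimes> (inv y \<otimes> x) = x" using x y by (simp add: m_assoc[symmetric])
    have "\<not> inv y \<otimes> x \<lesssim> \<one>"
      using leq_mult[of y "inv y \<otimes> x" \<one>] \<open>\<not> x \<lesssim> y\<close> eq x y by auto
    then have "logarithm c (inv y \<otimes> x) > 0" using logarithm_pos[OF c] x y by simp
    moreover have "logarithm c x = logarithm c y + logarithm c (inv y \<otimes> x)"
      using logarithm_mult[OF c y, of "inv y \<otimes> x"] eq x y by simp
    ultimately show False using le by simp
  qed
next
  assume le: "x \<lesssim> y"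
  have eq: "x \<otimes> (inv x \<otimes> y) = y" using x y by (simp add: m_assoc[symmetric])
  have "\<one> \<lesssim> inv x \<otimes> y" using leq_mult_cancel[of x \<one> "inv x \<otimes> y"] le eq x y by simp
  then have "0 \<le> logarithm c (inv x \<otimes> y)"
    using le_logarithm[OF c, of "inv x \<otimes> y" 1 0] x y by simp
  moreover have "logarithm c y = logarithm c x + logarithm c (inv x \<otimes> y)"
    using logarithm_mult[OF c x, of "inv x \<otimes> y"] eq x y by simp
  ultimately show "logarithm c x \<le> logarithm c y" by simp
qed

text \<open>
  Without an element strictly above \<open>1\<close> there is no base for the logarithm; but then all
  elements are equivalent, and the zero map does the job.
\<close>

theorem hoelder_embedding:
  obtains \<phi> :: "'a \<Rightarrow> real"
  where "\<And>x y. \<lbrakk>x \<in> carrier G; y \<in> carrier G\<rbrakk> \<Longrightarrow> \<phi> (x \<otimes> y) = \<phi> x + \<phi> y"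
    and "\<And>x y. \<lbrakk>x \<in> carrier G; y \<in> carrier G\<rbrakk> \<Longrightarrow> \<phi> x \<le> \<phi> y \<longleftrightarrow> x \<lesssim> y"
proof (cases "\<exists>c\<in>carrier G. \<not> c \<lesssim> \<one>")
  case True
  then obtain c where "c \<in> carrier G" "\<not> c \<lesssim> \<one>" by blast
  from logarithm_mult[OF this] logarithm_leq_iff[OF this] show ?thesis
    by (rule that[of "logarithm c"])
next
  case False
  have "x \<lesssim> y" if "x \<in> carrier G" "y \<in> carrier G" for x y
  proof -
    have "inv y \<otimes> x \<lesssim> \<one>" using False that by simp
    then show ?thesis
      using leq_mult[of y "inv y \<otimes> x" \<one>] that by (simp add: m_assoc[symmetric])
  qed
  then show ?thesis by (intro that[of "\<lambda>_. 0"]) auto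
qed

end

section \<open>Multiplicative representations of a preordered semifield\<close>

text \<open>
  An order embedding into the nonnegative reals as far as multiplication is concerned; addition
  is left open, so that the two possible addition laws can be derived from the value at
  \<open>1 + 1\<close>. Nonnegativity of \<open>f\<close> already encodes \<open>0 \<le> 1\<close> in \<open>F\<close>.
\<close>

locale multiplicative_representation = totally_preordered_semifield +
  fixes f :: "'a \<Rightarrow> real"
  assumes f_zero: "f \<zero> = 0"
    and f_nonneg: "x \<in> carrier F \<Longrightarrow> 0 \<le> f x"
    and f_mult: "\<lbrakk>x \<in> carrier F; y \<in> carrier F\<rbrakk> \<Longrightarrow> f (x \<otimes> y) = f x * f y"
    and f_le_iff: "\<lbrakk>x \<in> carrier F; y \<in> carrier F\<rbrakk> \<Longrightarrow> f x \<le> f y \<longleftrightarrow> x \<preceq> y"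
begin

lemma f_one: "f \<one> = 1"
proof -
  have "f \<one> = f \<one> * f \<one>" using f_mult[of \<one> \<one>] by simp
  moreover have "f \<one> \<noteq> 0"
    using f_le_iff[of \<zero> \<one>] f_le_iff[of \<one> \<zero>] f_zero le_nontrivial by auto
  ultimately show ?thesis by simp
qed

lemma le_add_both:
  assumes "a \<in> carrier F" "b \<in> carrier F" "x \<in> carrier F" "y \<in> carrier F" "a \<preceq> b" "x \<preceq> y"
  shows "a \<oplus> x \<preceq> b \<oplus> y"
proof (rule le_trans[of _ "a \<oplus> y"])
  show "a \<oplus> y \<preceq> b \<oplus> y"
    using le_add[of y a b] assms by (simp add: a_comm)
qed (use assms le_add in simp_all)

lemma zero_le: "x \<in> carrier F \<Longrightarrow> \<zero> \<preceq> x"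
  using f_le_iff[of \<zero> x] f_zero f_nonneg by simp

lemma embeds_tropical:
  assumes idem: "\<one> \<oplus> \<one> \<preceq> \<one>"
  shows "order_embeds F tropical_nonneg_reals"
proof -
  have add_le: "f (x \<oplus> y) = f y" if x: "x \<in> carrier F" and y: "y \<in> carrier F" and "x \<preceq> y" for x y
  proof (rule antisym)
    have "y \<otimes> (\<one> \<oplus> \<one>) \<preceq> y \<otimes> \<one>" using idem y by (intro le_mult) simp_all
    then have "y \<oplus> y \<preceq> y" using y by (simp add: r_distr)
    moreover have "x \<oplus> y \<preceq> y \<oplus> y" using le_add_both[of x y y y] le_refl that by simp
    ultimately have "x \<oplus> y \<preceq> y" using le_trans[of "x \<oplus> y" "y \<oplus> y" y] x y by simp
    then show "f (x \<oplus> y) \<le> f y" using f_le_iff x y by simp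
    have "\<zero> \<oplus> y \<preceq> x \<oplus> y" using le_add_both[of \<zero> x y y] zero_le le_refl x y by simp
    then show "f y \<le> f (x \<oplus> y)" using f_le_iff x y by simp
  qed
  have add: "f (x \<oplus> y) = max (f x) (f y)" if x: "x \<in> carrier F" and y: "y \<in> carrier F" for x y
  proof (cases "x \<preceq> y")
    case True
    then show ?thesis using add_le[OF x y] f_le_iff[OF x y] by simp
  next
    case False
    then have "y \<preceq> x" using le_total x y by blast
    then show ?thesis using add_le[OF y x] f_le_iff[OF y x] a_comm[OF x y] by simp
  qed
  show ?thesis unfolding order_embeds_def
    by (rule bexI[of _ f])
      (auto simp: tropical_nonneg_reals_def ring_hom_def f_zero f_nonneg f_mult f_one f_le_iff add)
qed

lemma f_nat_multiple:
  assumes two: "f (\<one> \<oplus> \<one>) = 2"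
  shows "f ([n] \<cdot> \<one>) = real n"
proof (cases "n = 0")
  case True
  then show ?thesis by (simp add: f_zero)
next
  case False
  define g where "g k = f ([k] \<cdot> \<one>)" for k :: nat
  have "g n = real n"
  proof (rule monotone_multiplicative_nat_fixing_two)
    show "g k \<le> g l" if "k \<le> l" for k l
    proof -
      have "\<zero> \<oplus> [k] \<cdot> \<one> \<preceq> [(l - k)] \<cdot> \<one> \<oplus> [k] \<cdot> \<one>"
        by (intro le_add_both zero_le le_refl) simp_all
      then have "[k] \<cdot> \<one> \<preceq> [l] \<cdot> \<one>" using that by (simp add: add.nat_pow_mult)
      then show ?thesis by (simp add: g_def f_le_iff)
    qed
    show "g (k * l) = g k * g l" for k l
    proof -
      have "[(k * l)] \<cdot> \<one> = [k] \<cdot> \<one> \<otimes> [l] \<cdot> \<one>"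
        by (simp add: add_pow_rdistr add.nat_pow_pow)
      then show ?thesis by (simp add: g_def f_mult)
    qed
    show "g 2 = 2" using two by (simp add: g_def numeral_2_eq_2)
  qed (use False in simp)
  then show ?thesis by (simp add: g_def)
qed

lemma f_nat_scale:
  assumes two: "f (\<one> \<oplus> \<one>) = 2" and x: "x \<in> carrier F"
  shows "f ([n] \<cdot> x) = real n * f x"
proof -
  have "[n] \<cdot> x = [n] \<cdot> \<one> \<otimes> x" using x by (simp add: add_pow_ldistr)
  then show ?thesis using x by (simp add: f_mult f_nat_multiple[OF two])
qed

text \<open>
  Rounding \<open>f (n \<cdot> x)\<close> and \<open>f (n \<cdot> y)\<close> to integers locates \<open>n \<cdot> x\<close> and \<open>n \<cdot> y\<close> between
  multiples of \<open>1\<close>. Inside \<open>F\<close> these bounds can be added, and \<open>f\<close> is known on the result.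
\<close>

lemma f_add:
  assumes two: "f (\<one> \<oplus> \<one>) = 2" and x: "x \<in> carrier F" and y: "y \<in> carrier F"
  shows "f (x \<oplus> y) = f x + f y"
proof -
  let ?d = "f (x \<oplus> y) - (f x + f y)"
  have "\<bar>real n * ?d\<bar> \<le> 2" for n
  proof -
    have bracket: "[nat \<lfloor>f z\<rfloor>] \<cdot> \<one> \<preceq> z \<and> z \<preceq> [nat \<lceil>f z\<rceil>] \<cdot> \<one>"
      if "z \<in> carrier F" for z
    proof -
      have "f ([nat \<lfloor>f z\<rfloor>] \<cdot> \<one>) \<le> f z" "f z \<le> f ([nat \<lceil>f z\<rceil>] \<cdot> \<one>)"
        using f_nonneg[OF that] by (simp_all add: f_nat_multiple[OF two])
      then show ?thesis using that by (simp add: f_le_iff)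
    qed
    define u v where "u = [n] \<cdot> x" and "v = [n] \<cdot> y"
    have uv: "u \<in> carrier F" "v \<in> carrier F" using x y by (simp_all add: u_def v_def)
    have "[nat \<lfloor>f u\<rfloor>] \<cdot> \<one> \<oplus> [nat \<lfloor>f v\<rfloor>] \<cdot> \<one> \<preceq> u \<oplus> v"
      using bracket uv by (intro le_add_both) simp_all
    then have "[(nat \<lfloor>f u\<rfloor> + nat \<lfloor>f v\<rfloor>)] \<cdot> \<one> \<preceq> u \<oplus> v"
      by (simp add: add.nat_pow_mult)
    then have lower: "real (nat \<lfloor>f u\<rfloor> + nat \<lfloor>f v\<rfloor>) \<le> f (u \<oplus> v)"
      using uv f_nat_multiple[OF two, of "nat \<lfloor>f u\<rfloor> + nat \<lfloor>f v\<rfloor>"]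
        f_le_iff[of "[(nat \<lfloor>f u\<rfloor> + nat \<lfloor>f v\<rfloor>)] \<cdot> \<one>" "u \<oplus> v"] by simp
    have "u \<oplus> v \<preceq> [nat \<lceil>f u\<rceil>] \<cdot> \<one> \<oplus> [nat \<lceil>f v\<rceil>] \<cdot> \<one>"
      using bracket uv by (intro le_add_both) simp_all
    then have "u \<oplus> v \<preceq> [(nat \<lceil>f u\<rceil> + nat \<lceil>f v\<rceil>)] \<cdot> \<one>"
      by (simp add: add.nat_pow_mult)
    then have upper: "f (u \<oplus> v) \<le> real (nat \<lceil>f u\<rceil> + nat \<lceil>f v\<rceil>)"
      using uv f_nat_multiple[OF two, of "nat \<lceil>f u\<rceil> + nat \<lceil>f v\<rceil>"]
        f_le_iff[of "u \<oplus> v" "[(nat \<lceil>f u\<rceil> + nat \<lceil>f v\<rceil>)] \<cdot> \<one>"] by simp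
    have "f (u \<oplus> v) = real n * f (x \<oplus> y)"
      using x y by (simp add: u_def v_def add.nat_pow_distrib[symmetric] f_nat_scale[OF two])
    moreover have "f u = real n * f x" "f v = real n * f y"
      using x y by (simp_all add: u_def v_def f_nat_scale[OF two])
    moreover have "\<bar>f (u \<oplus> v) - (f u + f v)\<bar> \<le> 2"
      using lower upper f_nonneg[OF uv(1)] f_nonneg[OF uv(2)] by simp linarith
    ultimately show ?thesis by (simp add: algebra_simps)
  qed
  then have "?d = 0" by (rule eq_zero_if_multiples_bounded)
  then show ?thesis by simp
qed

lemma embeds_nonneg_reals:
  assumes "f (\<one> \<oplus> \<one>) = 2"
  shows "order_embeds F nonneg_reals"
  unfolding order_embeds_def
  by (rule bexI[of _ f])
    (auto simp: nonneg_reals_def ring_hom_def f_zero f_nonneg f_mult f_one f_le_iff f_add[OF assms])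

end

section \<open>Embedding Archimedean semifields\<close>

context totally_preordered_semifield
begin

lemma Units_eq: "Units F = carrier F - {\<zero>}"
proof -
  have "\<zero> \<notin> Units F"
    using one_not_zero by (auto simp: Units_def)
  then show ?thesis using nonzero_invertible Units_closed by auto
qed

lemma archimedean_units_of:
  assumes "multiplicatively_archimedean F"
  shows "archimedean_group (units_of F) (le F)"
proof -
  interpret U: comm_group "units_of F" by (rule units_comm_group)
  show ?thesis
  proof
    show "x \<preceq> \<one>\<^bsub>units_of F\<^esub>"
      if "x \<in> carrier (units_of F)" "y \<in> carrier (units_of F)"
        "\<And>k::nat. x [^]\<^bsub>units_of F\<^esub> k \<preceq> y" for x y
      using assms that unfolding multiplicatively_archimedean_def
      by (simp add: units_of_carrier units_of_one units_of_pow Units_eq[symmetric]) blast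
  qed (auto simp: units_of_carrier units_of_mult Units_closed intro: le_trans le_mult
      dest: le_total[OF Units_closed Units_closed])
qed

text \<open>
  Rescaling a Hoelder embedding by a positive factor gives another one. The parameter \<open>s\<close>
  remains free in order to normalise \<open>f (1 + 1)\<close> later.
\<close>

lemma multiplicative_representation_exists:
  assumes arch: "multiplicatively_archimedean F" and pos: "\<zero> \<preceq> \<one>"
  obtains \<phi> :: "'a \<Rightarrow> real"
  where "\<And>s. s > 0 \<Longrightarrow>
    multiplicative_representation F (\<lambda>x. if x = \<zero> then 0 else exp (s * \<phi> x))"
proof -
  interpret U: archimedean_group "units_of F" "le F" by (rule archimedean_units_of[OF arch])
  obtain \<phi> :: "'a \<Rightarrow> real"
    where add: "\<And>x y. \<lbrakk>x \<in> Units F; y \<in> Units F\<rbrakk> \<Longrightarrow> \<phi> (x \<otimes> y) = \<phi> x + \<phi> y"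
      and le: "\<And>x y. \<lbrakk>x \<in> Units F; y \<in> Units F\<rbrakk> \<Longrightarrow> \<phi> x \<le> \<phi> y \<longleftrightarrow> x \<preceq> y"
    using U.hoelder_embedding unfolding units_of_carrier units_of_mult by metis
  have zero_le: "\<zero> \<preceq> x" if "x \<in> carrier F" for x
    using le_mult[OF that _ _ pos] that by simp
  have not_le_zero: "\<not> x \<preceq> \<zero>" if "x \<in> carrier F" "x \<noteq> \<zero>" for x
  proof
    assume "x \<preceq> \<zero>"
    have "x \<in> Units F" using that Units_eq by simp
    then have "\<one> \<preceq> \<zero>"
      using le_mult[of "inv x" x \<zero>] \<open>x \<preceq> \<zero>\<close> that by simp
    then show False using pos le_nontrivial by simp
  qed
  show ?thesis
  proof (rule that)
    fix s :: real assume s: "s > 0"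
    show "multiplicative_representation F (\<lambda>x. if x = \<zero> then 0 else exp (s * \<phi> x))"
    proof (unfold_locales, goal_cases)
      \<comment> \<open>Multiplicativity: a product of nonzero elements is a unit, hence nonzero.\<close>
      case (3 x y)
      have "x \<otimes> y \<noteq> \<zero>" if "x \<noteq> \<zero>" "y \<noteq> \<zero>"
        using Units_m_closed[of x y] 3 that by (simp add: Units_eq)
      then show ?case
        using 3 by (auto simp: add Units_eq distrib_left exp_add)
    next
      \<comment> \<open>Comparison: the zero element lies strictly below all units, in \<open>F\<close> as in the reals.\<close>
      case (4 x y)
      then show ?case
        using s by (auto simp: le[unfolded Units_eq] zero_le not_le_zero)
    qed simp_all
  qed
qed

lemma embeds_if_archimedean_positive:
  assumes arch: "multiplicatively_archimedean F" and pos: "\<zero> \<preceq> \<one>"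
  shows "order_embeds F nonneg_reals \<or> order_embeds F tropical_nonneg_reals"
proof -
  obtain \<phi> :: "'a \<Rightarrow> real" where \<phi>: "\<And>s. s > 0 \<Longrightarrow>
      multiplicative_representation F (\<lambda>x. if x = \<zero> then 0 else exp (s * \<phi> x))"
    using multiplicative_representation_exists[OF assms] by blast
  interpret one: multiplicative_representation F "\<lambda>x. if x = \<zero> then 0 else exp (1 * \<phi> x)"
    by (rule \<phi>) simp
  show ?thesis
  proof (cases "\<one> \<oplus> \<one> \<preceq> \<one>")
    case True
    then show ?thesis using one.embeds_tropical by simp
  next
    case False
    have nz: "\<one> \<oplus> \<one> \<noteq> \<zero>" using False pos by auto
    \<comment> \<open>This makes the image of \<open>1 + 1\<close> equal to \<open>exp (ln 2) = 2\<close>.\<close>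
    define s where "s = ln 2 / \<phi> (\<one> \<oplus> \<one>)"
    have "\<phi> \<one> = 0" using one.f_one one_not_zero by simp
    then have pos2: "\<phi> (\<one> \<oplus> \<one>) > 0"
      using False one.f_le_iff[of "\<one> \<oplus> \<one>" \<one>] nz one_not_zero by simp
    then have "s > 0" by (simp add: s_def)
    then interpret two: multiplicative_representation F
      "\<lambda>x. if x = \<zero> then 0 else exp (s * \<phi> x)" by (rule \<phi>)
    show ?thesis using two.embeds_nonneg_reals nz pos2 by (simp add: s_def)
  qed
qed

text \<open>
  Inversion reverses the preorder on nonzero elements, so lower bounds for the powers of \<open>x\<close>
  are upper bounds for the powers of its inverse.
\<close>

lemma multiplicatively_archimedean_opposite:
  assumes "multiplicatively_archimedean F"
  shows "multiplicatively_archimedean (opposite F)"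
proof -
  have pow: "x [^]\<^bsub>opposite F\<^esub> (k::nat) = x [^] k" for x k
    by (simp add: opposite_def nat_pow_def)
  have inv_le: "inv y \<preceq> inv x" if xy: "x \<in> Units F" "y \<in> Units F" "x \<preceq> y" for x y
  proof -
    have "inv x \<otimes> inv y \<otimes> x = inv y"
      using xy by (simp add: Units_closed m_comm[of "inv x" "inv y"] m_assoc)
    moreover have "inv x \<otimes> inv y \<otimes> y = inv x"
      using xy by (simp add: Units_closed m_assoc)
    ultimately show ?thesis
      using le_mult[of "inv x \<otimes> inv y" x y] xy by (simp add: Units_closed)
  qed
  have "\<one> \<preceq> x" if x: "x \<in> Units F" and y: "y \<in> Units F" and le: "\<And>k::nat. y \<preceq> x [^] k" for x y
  proof -
    have "(inv x) [^] k \<preceq> inv y" for k :: nat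
    proof -
      have "x [^] k \<in> Units F" by (induction k) (use x in simp_all)
      then have "inv (x [^] k) \<preceq> inv y" using inv_le[OF y _ le[of k]] by simp
      moreover have "inv (x [^] k) = (inv x) [^] k"
        using x by (intro comm_inv_char) (simp_all add: Units_closed nat_pow_distrib[symmetric])
      ultimately show ?thesis by simp
    qed
    then have "inv x \<preceq> \<one>"
      using assms x y Units_inv_Units unfolding multiplicatively_archimedean_def Units_eq[symmetric]
      by blast
    then show ?thesis using inv_le[of "inv x" \<one>] x by simp
  qed
  then show ?thesis
    unfolding multiplicatively_archimedean_def pow
    by (simp add: opposite_def Units_eq[symmetric])
qed

end

lemma order_embeds_opposite:
  assumes "order_embeds (opposite F) K"
  shows "order_embeds F (opposite K)"
proof -
  have "ring_hom F (opposite K) = ring_hom (opposite F) K"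
    by (simp add: ring_hom_def opposite_def)
  with assms show ?thesis
    unfolding order_embeds_def by (simp add: opposite_def) blast
qed

lemma embeds_if_archimedean:
  assumes "totally_preordered_semifield F" and arch: "multiplicatively_archimedean F"
  shows "order_embeds F nonneg_reals \<or> order_embeds F (opposite nonneg_reals) \<or>
    order_embeds F tropical_nonneg_reals \<or> order_embeds F (opposite tropical_nonneg_reals)"
proof -
  interpret totally_preordered_semifield F by fact
  show ?thesis
  proof (cases "\<zero>\<^bsub>F\<^esub> \<preceq>\<^bsub>F\<^esub> \<one>\<^bsub>F\<^esub>")
    case True
    then show ?thesis using embeds_if_archimedean_positive arch by blast
  next
    case False
    interpret opp: totally_preordered_semifield "opposite F"
      by (rule totally_preordered_semifield_opposite) fact
    have "\<zero>\<^bsub>opposite F\<^esub> \<preceq>\<^bsub>opposite F\<^esub> \<one>\<^bsub>opposite F\<^esub>"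
      using False le_total[of "\<one>\<^bsub>F\<^esub>" "\<zero>\<^bsub>F\<^esub>"] by (simp add: opposite_def)
    then show ?thesis
      using opp.embeds_if_archimedean_positive multiplicatively_archimedean_opposite[OF arch]
        order_embeds_opposite by blast
  qed
qed

section \<open>Inheritance of the Archimedean property along order embeddings\<close>

text \<open>
  A homomorphism sends units to units, so even a non-injective embedding maps nonzero elements
  to nonzero ones, and a bound on all powers can be transported to \<open>K\<close> and the conclusion back.
\<close>

lemma archimedean_if_order_embeds:
  assumes "totally_preordered_semifield F" and "totally_preordered_semifield K"
    and arch: "multiplicatively_archimedean K" and emb: "order_embeds F K"
  shows "multiplicatively_archimedean F"
proof -
  interpret F: totally_preordered_semifield F by fact
  interpret K: totally_preordered_semifield K by fact
  obtain f where hom: "f \<in> ring_hom F K"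
    and le: "\<And>x y. \<lbrakk>x \<in> carrier F; y \<in> carrier F\<rbrakk> \<Longrightarrow> x \<preceq>\<^bsub>F\<^esub> y \<longleftrightarrow> f x \<preceq>\<^bsub>K\<^esub> f y"
    using emb by (auto simp: order_embeds_def)
  have unit: "f x \<in> Units K" if "x \<in> Units F" for x
  proof -
    have "f x \<otimes>\<^bsub>K\<^esub> f (inv\<^bsub>F\<^esub> x) = \<one>\<^bsub>K\<^esub>"
      using ring_hom_mult[OF hom, of x "inv\<^bsub>F\<^esub> x"] ring_hom_one[OF hom] that
      by (simp add: F.Units_closed)
    moreover have "f x \<in> carrier K" "f (inv\<^bsub>F\<^esub> x) \<in> carrier K"
      using ring_hom_closed[OF hom] that by (simp_all add: F.Units_closed)
    ultimately show ?thesis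
      using K.m_comm[of "f x" "f (inv\<^bsub>F\<^esub> x)"] unfolding Units_def by auto
  qed
  have pow: "f (x [^]\<^bsub>F\<^esub> k) = f x [^]\<^bsub>K\<^esub> k" if "x \<in> carrier F" for x and k :: nat
    by (induction k) (use that ring_hom_mult[OF hom] ring_hom_one[OF hom] in simp_all)
  show ?thesis
    unfolding multiplicatively_archimedean_def F.Units_eq[symmetric]
  proof (intro ballI impI)
    fix x y assume x: "x \<in> Units F" and y: "y \<in> Units F"
      and "\<forall>k::nat. x [^]\<^bsub>F\<^esub> k \<preceq>\<^bsub>F\<^esub> y"
    then have "\<forall>k::nat. f x [^]\<^bsub>K\<^esub> k \<preceq>\<^bsub>K\<^esub> f y"
      using le F.Units_closed by (simp add: pow[symmetric])
    then have "f x \<preceq>\<^bsub>K\<^esub> \<one>\<^bsub>K\<^esub>"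
      using arch unit[OF x] unit[OF y]
      unfolding multiplicatively_archimedean_def K.Units_eq[symmetric] by blast
    then show "x \<preceq>\<^bsub>F\<^esub> \<one>\<^bsub>F\<^esub>"
      using le[of x "\<one>\<^bsub>F\<^esub>"] x ring_hom_one[OF hom] by (simp add: F.Units_closed)
  qed
qed

lemma archimedean_nonneg_reals: "multiplicatively_archimedean nonneg_reals"
proof -
  have "x [^]\<^bsub>nonneg_reals\<^esub> k = x ^ k" for x and k :: nat
    by (induction k) (simp_all add: nonneg_reals_def)
  then show ?thesis
    unfolding multiplicatively_archimedean_def
    using le_one_if_powers_bounded by (auto simp: nonneg_reals_def)
qed

lemma archimedean_tropical_nonneg_reals: "multiplicatively_archimedean tropical_nonneg_reals"
proof -
  have "x [^]\<^bsub>tropical_nonneg_reals\<^esub> k = x ^ k" for x and k :: nat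
    by (induction k) (simp_all add: tropical_nonneg_reals_def)
  then show ?thesis
    unfolding multiplicatively_archimedean_def
    using le_one_if_powers_bounded by (auto simp: tropical_nonneg_reals_def)
qed

theorem theorem4p2:
  fixes F :: "('a, 'm) preordered_ring_scheme"
  assumes "totally_preordered_semifield F"
  shows "multiplicatively_archimedean F \<longleftrightarrow>
    order_embeds F nonneg_reals \<or> order_embeds F (opposite nonneg_reals) \<or>
    order_embeds F tropical_nonneg_reals \<or> order_embeds F (opposite tropical_nonneg_reals)"
proof
  show "multiplicatively_archimedean F" if
    "order_embeds F nonneg_reals \<or> order_embeds F (opposite nonneg_reals) \<or>
     order_embeds F tropical_nonneg_reals \<or> order_embeds F (opposite tropical_nonneg_reals)"
  proof -
    note real = totally_preordered_semifield_nonneg_reals archimedean_nonneg_reals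
    note tropical = totally_preordered_semifield_tropical_nonneg_reals
      archimedean_tropical_nonneg_reals
    note opp = totally_preordered_semifield_opposite
      totally_preordered_semifield.multiplicatively_archimedean_opposite
    show ?thesis
      using that archimedean_if_order_embeds[OF assms real]
        archimedean_if_order_embeds[OF assms opp(1)[OF real(1)] opp(2)[OF real]]
        archimedean_if_order_embeds[OF assms tropical]
        archimedean_if_order_embeds[OF assms opp(1)[OF tropical(1)] opp(2)[OF tropical]]
      by argo
  qed
qed (rule embeds_if_archimedean[OF assms])

end
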